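(* Let $\Sigma_{\mathcal P}\sim(A,B,C,D)$ be a poset-causal system with underlying poset $\mathcal P=(P,\succeq)$, $P=\{1,\dots,p\}$, state space $\mathcal X=\bigoplus_{j\in P}\mathcal X_j$ and unobservable subspace $\mathcal N=\mathcal N(C,A)$, and let $\overline{\mathcal N}$, $\mathcal N^\circ$, $\widetilde{\mathcal N}$ be the associated structured subspaces. Then $$\overline{\mathcal N}\subseteq\mathcal N\subseteq\mathcal N^\circ\subseteq\widetilde{\mathcal N},\quad\text{so that}\quad \widetilde{\mathcal N}^\perp\subseteq(\mathcal N^{\circ})^\perp\subseteq\mathcal N^\perp\subseteq\overline{\mathcal N}^\perp,$$ and, for each $j\in P$, $$\overline{\mathcal N}^j=\mathcal X_j\cap\mathcal N,\quad\text{so that}\quad P_{\mathcal X_j}\mathcal N^\perp=\mathcal X_j\ominus\overline{\mathcal N}^j.$$ In particular, if $\Sigma_{\mathcal P}$ is independently observable, then $\Sigma_{\mathcal P}$ is observable, and if $\Sigma_{\mathcal P}$ is observable, then $\Sigma_{\mathcal P}$ is weakly downstream observable. Furthermore, if $$\mathcal Q=\bigoplus_{j\in P}\mathcal Q_j\quad\text{and}\quad\mathcal S=\bigoplus_{j\in P}\mathcal S_j\quad\text{are such that}\quad\mathcal Q\subseteq\mathcal N\subseteq\mathcal S,$$ where $\mathcal Q_j\subseteq\mathcal X_j$ and $\mathcal S_j\subseteq\mathcal X_j$ are subspaces for each $j\in P$, then $\mathcal Q\subseteq\overline{\mathcal N}$ and $\mathcal N^\circ\subseteq\mathcal S$.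
   Context: Let $\mathcal P=(P,\succeq)$ be a partially ordered set with $P=\{1,\dots,p\}$. For $i\in P$ put ${\downarrow}i=\{j\in P: i\succeq j\}$ and ${\uparrow}i=\{j\in P: j\succeq i\}$. A partition is a tuple $\underline n=(n_1,\dots,n_p)$ of nonnegative integers. $\mathcal I_{\mathcal P}^{\underline n\times\underline m}$ is the space of real block matrices $G=[G_{ij}]_{i,j=1}^p$ with $G_{ij}\in\mathbb R^{n_i\times m_j}$ and $G_{ij}=0$ whenever $j\not\succeq i$. For $R,S\subseteq P$, $G(R,S)$ is the block submatrix of $G$ with block rows indexed by $R$ and block columns indexed by $S$ (a singleton $\{i\}$ is written $i$). A poset-causal system $\Sigma_{\mathcal P}\sim(A,B,C,D)$ is the linear system $\dot x=Ax+Bu$, $y=Cx+Du$ with $A\in\mathcal I_{\mathcal P}^{\underline n\times\underline n}$, $B\in\mathcal I_{\mathcal P}^{\underline n\times\underline m}$, $C\in\mathcal I_{\mathcal P}^{\underline r\times\underline n}$, $D\in\mathcal I_{\mathcal P}^{\underline r\times\underline m}$. Local state spaces are $\mathcal X_i=\mathbb R^{n_i}$, and $\mathcal X=\bigoplus_{i\in P}\mathcal X_i$ (orthogonal direct sum); for $S\subseteq P$, $\mathcal X_S=\bigoplus_{j\in S}\mathcal X_j$, viewed as a subspace of $\mathcal X$. $P_{\mathcal X_j}$ is the orthogonal projection onto $\mathcal X_j$; for subspaces $\mathcal W\subseteq\mathcal V$, $\mathcal V\ominus\mathcal W$ is the orthogonal complement of $\mathcal W$ in $\mathcal V$; $\perp$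 denotes orthogonal complement in $\mathcal X$. For a pair $(C,A)$ with $A$ of size $N\times N$, $\mathcal N(C,A)=\bigcap_{k=0}^{N-1}\ker CA^k$. Write $\mathcal N=\mathcal N(C,A)$; the system is observable if $\mathcal N=\{0\}$. The $i$-upstream indistinguishable set is $\mathcal N_i=\mathcal N(C(i,{\uparrow}i),A({\uparrow}i,{\uparrow}i))\subseteq\mathcal X_{{\uparrow}i}$. For $i\in P$ and $j\in{\uparrow}i$ put $\overline{\mathcal N}_i^j=\mathcal N_i\cap\mathcal X_j$ and $\widetilde{\mathcal N}_i^j=P_{\mathcal X_j}\mathcal N_i$. For $j\in P$ put $$\overline{\mathcal N}^j=\bigcap_{i\in{\downarrow}j}\overline{\mathcal N}_i^j,\qquad\mathcal N^{\circ j}=P_{\mathcal X_j}\mathcal N,\qquad\widetilde{\mathcal N}^j=\bigcap_{i\in{\downarrow}j}\widetilde{\mathcal N}_i^j,$$ and $\overline{\mathcal N}=\bigoplus_{j\in P}\overline{\mathcal N}^j$, $\mathcal N^\circ=\bigoplus_{j\in P}\mathcal N^{\circ j}$, $\widetilde{\mathcal N}=\bigoplus_{j\in P}\widetilde{\mathcal N}^j$. The system is independently observable if $\widetilde{\mathcal N}=\{0\}$ and weakly downstream observable if $\overline{\mathcal N}=\{0\}$. *)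

theory Defs
  imports Jordan_Normal_Form.Matrix_Kernel Jordan_Normal_Form.DL_Submatrix
begin

(* Block matrices are plain real matrices whose (0-based) index range is cut into p consecutive
   intervals; block k of a partition n is the interval of length n k that follows
   blocks 1, ..., k-1.  Blocks of size 0 are allowed. *)

definition total :: "nat \<Rightarrow> (nat \<Rightarrow> nat) \<Rightarrow> nat" where
  "total p n = (\<Sum>k=1..p. n k)"

definition block_inds :: "(nat \<Rightarrow> nat) \<Rightarrow> nat set \<Rightarrow> nat set" where
  "block_inds n S = (\<Union>k\<in>S. {(\<Sum>l=1..<k. n l) ..< (\<Sum>l=1..k. n l)})"

text \<open>The block submatrix G(R,S), where the rows are partitioned by n and the columns by m.\<close>

definition block_submatrix ::
  "(nat \<Rightarrow> nat) \<Rightarrow> (nat \<Rightarrow> nat) \<Rightarrow> real mat \<Rightarrow> nat set \<Rightarrow> nat set \<Rightarrow> real mat" where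
  "block_submatrix n m G R S = submatrix G (block_inds n R) (block_inds m S)"

text \<open>The order relation contains the pair (j,i) iff j \<open>\<succeq>\<close> i.\<close>

definition incidence_space ::
  "nat \<Rightarrow> nat rel \<Rightarrow> (nat \<Rightarrow> nat) \<Rightarrow> (nat \<Rightarrow> nat) \<Rightarrow> real mat set" where
  "incidence_space p ge n m =
     {G \<in> carrier_mat (total p n) (total p m).
        \<forall>i\<in>{1..p}. \<forall>j\<in>{1..p}. (j, i) \<notin> ge \<longrightarrow>
          block_submatrix n m G {i} {j} = 0\<^sub>m (n i) (m j)}"

record poset_system =
  psize :: nat
  pord :: "nat rel"
  xpart :: "nat \<Rightarrow> nat"
  upart :: "nat \<Rightarrow> nat"
  ypart :: "nat \<Rightarrow> nat"
  matA :: "real mat"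
  matB :: "real mat"
  matC :: "real mat"
  matD :: "real mat"

definition poset_causal_system :: "poset_system \<Rightarrow> bool" where
  "poset_causal_system \<Sigma> \<longleftrightarrow>
     partial_order_on {1..psize \<Sigma>} (pord \<Sigma>) \<and>
     matA \<Sigma> \<in> incidence_space (psize \<Sigma>) (pord \<Sigma>) (xpart \<Sigma>) (xpart \<Sigma>) \<and>
     matB \<Sigma> \<in> incidence_space (psize \<Sigma>) (pord \<Sigma>) (xpart \<Sigma>) (upart \<Sigma>) \<and>
     matC \<Sigma> \<in> incidence_space (psize \<Sigma>) (pord \<Sigma>) (ypart \<Sigma>) (xpart \<Sigma>) \<and>
     matD \<Sigma> \<in> incidence_space (psize \<Sigma>) (pord \<Sigma>) (ypart \<Sigma>) (upart \<Sigma>)"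

definition upset :: "poset_system \<Rightarrow> nat \<Rightarrow> nat set" where
  "upset \<Sigma> i = {j \<in> {1..psize \<Sigma>}. (j, i) \<in> pord \<Sigma>}"

definition downset :: "poset_system \<Rightarrow> nat \<Rightarrow> nat set" where
  "downset \<Sigma> i = {j \<in> {1..psize \<Sigma>}. (i, j) \<in> pord \<Sigma>}"

abbreviation xdim :: "poset_system \<Rightarrow> nat" where
  "xdim \<Sigma> \<equiv> total (psize \<Sigma>) (xpart \<Sigma>)"

definition state_space :: "poset_system \<Rightarrow> real vec set" where
  "state_space \<Sigma> = carrier_vec (xdim \<Sigma>)"

text \<open>The local state space of j, as a subspace of the full state space.\<close>

definition local_space :: "poset_system \<Rightarrow> nat \<Rightarrow> real vec set" where
  "local_space \<Sigma> j =
     {x \<in> state_space \<Sigma>. \<forall>k<xdim \<Sigma>. k \<notin> block_inds (xpart \<Sigma>) {j} \<longrightarrow> x $ k = 0}"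

text \<open>Sum of the subspaces \<open>W j\<close> for \<open>j \<in> S\<close>; it is only applied to subspaces of the
  pairwise orthogonal local state spaces, for which it is the orthogonal direct sum.\<close>

definition orth_sum :: "poset_system \<Rightarrow> nat set \<Rightarrow> (nat \<Rightarrow> real vec set) \<Rightarrow> real vec set" where
  "orth_sum \<Sigma> S W =
     {finsum_vec TYPE(real) (xdim \<Sigma>) w S | w. \<forall>j\<in>S. w j \<in> W j}"

definition local_sum :: "poset_system \<Rightarrow> nat set \<Rightarrow> real vec set" where
  "local_sum \<Sigma> S = orth_sum \<Sigma> S (local_space \<Sigma>)"

definition is_subspace :: "poset_system \<Rightarrow> real vec set \<Rightarrow> bool" where
  "is_subspace \<Sigma> W \<longleftrightarrow>
     VectorSpace.subspace class_ring W (module_vec TYPE(real) (xdim \<Sigma>))"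

definition ominus :: "real vec set \<Rightarrow> real vec set \<Rightarrow> real vec set" (infixl "\<ominus>\<^sub>v" 65) where
  "V \<ominus>\<^sub>v W = {v \<in> V. \<forall>w\<in>W. v \<bullet> w = 0}"

definition perp :: "poset_system \<Rightarrow> real vec set \<Rightarrow> real vec set" where
  "perp \<Sigma> W = state_space \<Sigma> \<ominus>\<^sub>v W"

definition orth_proj :: "real vec set \<Rightarrow> real vec \<Rightarrow> real vec" where
  "orth_proj V x = (THE v. v \<in> V \<and> (\<forall>w\<in>V. (x - v) \<bullet> w = 0))"

definition local_proj :: "poset_system \<Rightarrow> nat \<Rightarrow> real vec set \<Rightarrow> real vec set" where
  "local_proj \<Sigma> j W = orth_proj (local_space \<Sigma> j) ` W"

definition unobservable_space :: "real mat \<Rightarrow> real mat \<Rightarrow> real vec set" where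
  "unobservable_space C A =
     {x \<in> carrier_vec (dim_row A). \<forall>k<dim_row A. x \<in> mat_kernel (C * A ^\<^sub>m k)}"

definition unobs :: "poset_system \<Rightarrow> real vec set" where
  "unobs \<Sigma> = unobservable_space (matC \<Sigma>) (matA \<Sigma>)"

text \<open>The vector of the entries of x with index in I, enumerated in increasing order as in
  \<^const>\<open>submatrix\<close>.  It identifies the subspace \<open>local_sum \<Sigma> S\<close> with the space of
  column vectors on which the block submatrices with block columns S act.\<close>

definition subvector :: "real vec \<Rightarrow> nat set \<Rightarrow> real vec" where
  "subvector x I = vec (card {k. k < dim_vec x \<and> k \<in> I}) (\<lambda>k. x $ pick I k)"

definition upstream_indist :: "poset_system \<Rightarrow> nat \<Rightarrow> real vec set" where
  "upstream_indist \<Sigma> i =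
     {x \<in> local_sum \<Sigma> (upset \<Sigma> i).
        subvector x (block_inds (xpart \<Sigma>) (upset \<Sigma> i)) \<in>
          unobservable_space
            (block_submatrix (ypart \<Sigma>) (xpart \<Sigma>) (matC \<Sigma>) {i} (upset \<Sigma> i))
            (block_submatrix (xpart \<Sigma>) (xpart \<Sigma>) (matA \<Sigma>) (upset \<Sigma> i) (upset \<Sigma> i))}"

definition Nbar_loc :: "poset_system \<Rightarrow> nat \<Rightarrow> real vec set" where
  "Nbar_loc \<Sigma> j = (\<Inter>i\<in>downset \<Sigma> j. upstream_indist \<Sigma> i \<inter> local_space \<Sigma> j)"

definition Ncirc_loc :: "poset_system \<Rightarrow> nat \<Rightarrow> real vec set" where
  "Ncirc_loc \<Sigma> j = local_proj \<Sigma> j (unobs \<Sigma>)"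

definition Ntilde_loc :: "poset_system \<Rightarrow> nat \<Rightarrow> real vec set" where
  "Ntilde_loc \<Sigma> j = (\<Inter>i\<in>downset \<Sigma> j. local_proj \<Sigma> j (upstream_indist \<Sigma> i))"

definition Nbar :: "poset_system \<Rightarrow> real vec set" where
  "Nbar \<Sigma> = orth_sum \<Sigma> {1..psize \<Sigma>} (Nbar_loc \<Sigma>)"

definition Ncirc :: "poset_system \<Rightarrow> real vec set" where
  "Ncirc \<Sigma> = orth_sum \<Sigma> {1..psize \<Sigma>} (Ncirc_loc \<Sigma>)"

definition Ntilde :: "poset_system \<Rightarrow> real vec set" where
  "Ntilde \<Sigma> = orth_sum \<Sigma> {1..psize \<Sigma>} (Ntilde_loc \<Sigma>)"

definition observable :: "poset_system \<Rightarrow> bool" where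
  "observable \<Sigma> \<longleftrightarrow> unobs \<Sigma> = {0\<^sub>v (xdim \<Sigma>)}"

definition independently_observable :: "poset_system \<Rightarrow> bool" where
  "independently_observable \<Sigma> \<longleftrightarrow> Ntilde \<Sigma> = {0\<^sub>v (xdim \<Sigma>)}"

definition weakly_downstream_observable :: "poset_system \<Rightarrow> bool" where
  "weakly_downstream_observable \<Sigma> \<longleftrightarrow> Nbar \<Sigma> = {0\<^sub>v (xdim \<Sigma>)}"

end

theory Submission
  imports Defs Jordan_Normal_Form.Determinant
begin

text \<open>Because \<open>A\<close> and \<open>C\<close> lie in the incidence space, the block \<open>i\<close> of \<open>C A\<^sup>k x\<close> depends only on the
  entries of \<open>x\<close> in \<open>\<up>i\<close> and is computed by the corresponding submatrices.  By a Krylov argument the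
  bound \<open>k < N\<close> in the unobservable spaces may be dropped, although it differs between the
  full system and its upstream parts.  Hence both \<open>\<N>\<close> and the \<open>\<N>\<^sub>i\<close> are cut out by the vanishing of
  blocks of \<open>C A\<^sup>k x\<close> for all \<open>k\<close>, and a vector of \<open>\<X>\<^sub>j\<close> automatically has zero block \<open>i\<close> unless
  \<open>i \<in> \<down>j\<close>.  The formula for the projection of \<open>\<N>\<^sup>\<bottom>\<close> is linear duality: a vector that
  annihilates \<open>\<X>\<^sub>j \<inter> \<N>\<close> is a combination of the rows of the \<open>C A\<^sup>k\<close> restricted to block \<open>j\<close>.\<close>


section \<open>Submatrices and subvectors as coordinate selection\<close>

lemma pick_bij_betw:
  assumes "finite I"
  shows "bij_betw (pick I) {..<card I} I"
proof -
  have "i \<in> pick I ` {..<card I}" if "i \<in> I" for i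
  proof -
    \<comment> \<open>The preimage of \<open>i\<close> under \<open>pick I\<close> is its rank in
      \<open>I\<close>. Surjectivity suffices, since both sides have the same finite
      cardinality.\<close>
    have "card {a \<in> I. a < i} < card I"
      using that assms by (intro psubset_card_mono) auto
    then show ?thesis
      using pick_card_in_set[OF that] by (intro image_eqI[of _ _ "card {a \<in> I. a < i}"]) auto
  qed
  moreover have "pick I ` {..<card I} \<subseteq> I"
    using pick_in_set_le by auto
  ultimately have "pick I ` {..<card I} = I"
    by blast
  then show ?thesis
    by (simp add: bij_betw_def eq_card_imp_inj_on)
qed

lemma card_below: "I \<subseteq> {..<n} \<Longrightarrow> card {k. k < n \<and> k \<in> I} = card I" for n :: nat
  by (rule arg_cong[where f = card]) auto

lemma submatrix_carrier:
  assumes "G \<in> carrier_mat nr nc" "I \<subseteq> {..<nr}" "J \<subseteq> {..<nc}"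
  shows "submatrix G I J \<in> carrier_mat (card I) (card J)"
  using assms by (intro carrier_matI) (simp_all add: dim_submatrix card_below)

lemma dim_subvector:
  "x \<in> carrier_vec n \<Longrightarrow> I \<subseteq> {..<n} \<Longrightarrow> dim_vec (subvector x I) = card I"
  by (simp add: subvector_def card_below)

lemma subvector_eq_iff:
  assumes "x \<in> carrier_vec n" "y \<in> carrier_vec n" "I \<subseteq> {..<n}"
  shows "subvector x I = subvector y I \<longleftrightarrow> (\<forall>a\<in>I. x $ a = y $ a)"
proof -
  have "subvector x I = subvector y I \<longleftrightarrow> (\<forall>c\<in>{..<card I}. x $ pick I c = y $ pick I c)"
    using assms by (auto simp: vec_eq_iff subvector_def card_below)
  also have "\<dots> \<longleftrightarrow> (\<forall>a\<in>I. x $ a = y $ a)"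
    using bij_betw_ball[OF pick_bij_betw[OF finite_subset[OF assms(3) finite_lessThan]],
        of "\<lambda>a. x $ a = y $ a"] by (rule sym)
  finally show ?thesis .
qed

lemma subvector_eq_0_iff:
  assumes "x \<in> carrier_vec n" "I \<subseteq> {..<n}"
  shows "subvector x I = 0\<^sub>v (card I) \<longleftrightarrow> (\<forall>a\<in>I. x $ a = 0)"
proof -
  have "pick I c < n" if "c < card I" for c
    using pick_in_set_le[OF that] assms(2) by auto
  then have "subvector (0\<^sub>v n) I = 0\<^sub>v (card I)"
    using assms(2) by (intro eq_vecI) (simp_all add: subvector_def card_below)
  moreover have "\<forall>a\<in>I. 0\<^sub>v n $ a = (0 :: real)"
    using assms(2) by auto
  ultimately show ?thesis
    using subvector_eq_iff[OF assms(1) zero_carrier_vec assms(2)] by simp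
qed

text \<open>A row with index in \<open>I\<close> has its support in \<open>J\<close>, so the
  coordinates of \<open>x\<close> outside \<open>J\<close> do not enter its product. The enumeration
  by \<open>pick\<close> only reorders the remaining sum.\<close>

lemma submatrix_mult_subvector:
  assumes G: "G \<in> carrier_mat nr nc" and x: "x \<in> carrier_vec nc"
    and I: "I \<subseteq> {..<nr}" and J: "J \<subseteq> {..<nc}"
    and zero: "\<And>a b. a \<in> I \<Longrightarrow> b < nc \<Longrightarrow> b \<notin> J \<Longrightarrow> G $$ (a, b) = 0"
  shows "submatrix G I J *\<^sub>v subvector x J = subvector (G *\<^sub>v x) I"
proof (rule eq_vecI)
  show dim: "dim_vec (submatrix G I J *\<^sub>v subvector x J) = dim_vec (subvector (G *\<^sub>v x) I)"
    using assms by (simp add: dim_submatrix subvector_def)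
  fix r assume "r < dim_vec (subvector (G *\<^sub>v x) I)"
  then have r: "r < card I"
    using G I by (simp add: subvector_def card_below)
  have fin: "finite I" "finite J"
    using I J finite_subset by blast+
  have pr: "pick I r \<in> I"
    using r by (rule pick_in_set_le)
  have prn: "pick I r < nr"
    using pr I by auto
  have row: "r < card {i. i < dim_row G \<and> i \<in> I}"
    using r G I by (simp add: card_below)
  have cJ: "card {i. i < dim_col G \<and> i \<in> J} = card J"
    using G J by (simp add: card_below)
  have cJ': "card {i. i < dim_vec x \<and> i \<in> J} = card J"
    using x J by (simp add: card_below)
  have "(submatrix G I J *\<^sub>v subvector x J) $ r
      = (\<Sum>c<card J. G $$ (pick I r, pick J c) * x $ pick J c)"
    using row cJ cJ'
    by (simp add: dim_submatrix scalar_prod_def subvector_def submatrix_index atLeast0LessThan)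
  also have "\<dots> = (\<Sum>b\<in>J. G $$ (pick I r, b) * x $ b)"
    by (rule sum.reindex_bij_betw[OF pick_bij_betw[OF fin(2)]])
  also have "\<dots> = (\<Sum>b<nc. G $$ (pick I r, b) * x $ b)"
    using J zero[OF pr] by (intro sum.mono_neutral_left) auto
  also have "\<dots> = (G *\<^sub>v x) $ pick I r"
    using G x prn by (simp add: scalar_prod_def atLeast0LessThan)
  also have "\<dots> = subvector (G *\<^sub>v x) I $ r"
    using row by (simp add: subvector_def)
  finally show "(submatrix G I J *\<^sub>v subvector x J) $ r = subvector (G *\<^sub>v x) I $ r" .
qed

section \<open>Matrix powers, Krylov sequences and linear duality\<close>

lemma pow_Suc_mult_mat_vec:
  assumes "A \<in> carrier_mat n n" "x \<in> carrier_vec n"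
  shows "A ^\<^sub>m Suc k *\<^sub>v x = A ^\<^sub>m k *\<^sub>v (A *\<^sub>v x)"
  using assms by (simp add: assoc_mult_mat_vec[OF pow_carrier_mat])

lemma pow_add_mult_mat_vec:
  fixes A :: "real mat"
  assumes "A \<in> carrier_mat n n" "x \<in> carrier_vec n"
  shows "A ^\<^sub>m (k + l) *\<^sub>v x = A ^\<^sub>m k *\<^sub>v (A ^\<^sub>m l *\<^sub>v x)"
  using assms(2)
proof (induction l arbitrary: x)
  case 0
  then show ?case using assms(1) by simp
next
  case (Suc l)
  then show ?case
    using assms(1) pow_Suc_mult_mat_vec[OF assms(1)] by (simp del: pow_mat.simps)
qed

text \<open>The zero pattern says that the vectors vanishing on \<open>I\<close> form an
  \<open>A\<close>-invariant subspace; the submatrix is the map induced on the quotient, and passing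
  to a quotient commutes with powers.\<close>

lemma submatrix_pow_mult_subvector:
  fixes A :: "real mat"
  assumes A: "A \<in> carrier_mat n n" and x: "x \<in> carrier_vec n" and I: "I \<subseteq> {..<n}"
    and zero: "\<And>a b. a \<in> I \<Longrightarrow> b < n \<Longrightarrow> b \<notin> I \<Longrightarrow> A $$ (a, b) = 0"
  shows "submatrix A I I ^\<^sub>m k *\<^sub>v subvector x I = subvector (A ^\<^sub>m k *\<^sub>v x) I"
  using x
proof (induction k arbitrary: x)
  case 0
  have "submatrix A I I \<in> carrier_mat (card I) (card I)"
    by (rule submatrix_carrier[OF A I I])
  moreover have "subvector x I \<in> carrier_vec (card I)"
    by (rule carrier_vecI[OF dim_subvector[OF 0 I]])
  ultimately show ?case using 0 A by simp
next
  case (Suc k)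
  have S: "submatrix A I I \<in> carrier_mat (card I) (card I)"
    by (rule submatrix_carrier[OF A I I])
  have s: "subvector x I \<in> carrier_vec (card I)"
    by (rule carrier_vecI[OF dim_subvector[OF Suc.prems I]])
  have Ax: "A *\<^sub>v x \<in> carrier_vec n"
    using A Suc.prems by simp
  have step: "submatrix A I I *\<^sub>v subvector x I = subvector (A *\<^sub>v x) I"
    by (rule submatrix_mult_subvector[OF A Suc.prems I I zero])
  show ?case
    unfolding pow_Suc_mult_mat_vec[OF A Suc.prems] pow_Suc_mult_mat_vec[OF S s] step
    by (rule Suc.IH[OF Ax])
qed

text \<open>The vectors \<open>v\<close>, \<open>A v\<close>, ..., \<open>A^n v\<close> are n+1
  vectors in dimension n, hence dependent. This replaces the theorem of Cayley and Hamilton by a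
  relation for the single vector \<open>v\<close>.\<close>

lemma krylov_dependence:
  fixes A :: "real mat"
  assumes A: "A \<in> carrier_mat n n" and v: "v \<in> carrier_vec n"
  obtains u :: "nat \<Rightarrow> real" and m where "m \<le> n" "u m \<noteq> 0"
    "\<And>q. q < n \<Longrightarrow> (\<Sum>j\<le>m. u j * (A ^\<^sub>m j *\<^sub>v v) $ q) = 0"
proof -
  \<comment> \<open>The columns are the Krylov vectors. A zero row makes the matrix square, so that
    its vanishing determinant provides a kernel vector.\<close>
  let ?M = "mat\<^sub>r (Suc n) (Suc n) (\<lambda>i. if i = n then 0\<^sub>v (Suc n)
              else vec (Suc n) (\<lambda>j. (A ^\<^sub>m j *\<^sub>v v) $ i))"
  have M: "?M \<in> carrier_mat (Suc n) (Suc n)"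
    by simp
  have "det ?M = 0"
    by (rule det_row_0) auto
  then obtain w where w: "w \<in> carrier_vec (Suc n)" "w \<noteq> 0\<^sub>v (Suc n)" "?M *\<^sub>v w = 0\<^sub>v (Suc n)"
    using det_0_iff_vec_prod_zero[OF M] by blast
  let ?I = "{j. j \<le> n \<and> w $ j \<noteq> 0}"
  have ne: "?I \<noteq> {}"
    using w(1,2) by (auto simp: vec_eq_iff less_Suc_eq_le)
  have fin: "finite ?I" by simp
  \<comment> \<open>Cutting the relation at its last nonzero coefficient lets it be solved for the
    highest power that occurs.\<close>
  define m where "m = Max ?I"
  have m: "m \<in> ?I" unfolding m_def by (rule Max_in[OF fin ne])
  have big: "w $ j = 0" if "m < j" "j \<le> n" for j
    using that Max_ge[OF fin, of j] unfolding m_def by fastforce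
  show ?thesis
  proof (rule that[of m "\<lambda>j. w $ j"])
    fix q assume q: "q < n"
    have "0 = (?M *\<^sub>v w) $ q"
      using w(3) q by simp
    also have "\<dots> = (\<Sum>j\<le>n. (A ^\<^sub>m j *\<^sub>v v) $ q * w $ j)"
      using q w(1) by (simp add: scalar_prod_def atLeast0LessThan lessThan_Suc_atMost
          del: sum.lessThan_Suc)
    also have "\<dots> = (\<Sum>j\<le>m. (A ^\<^sub>m j *\<^sub>v v) $ q * w $ j)"
      using m big by (intro sum.mono_neutral_right) auto
    finally show "(\<Sum>j\<le>m. w $ j * (A ^\<^sub>m j *\<^sub>v v) $ q) = 0"
      by (simp add: mult.commute)
  qed (use m in auto)
qed

text \<open>The dependence relation turns each coordinate of the sequence into a solution of a
  linear recurrence of order m, at most n, with nonzero leading coefficient. Such a solution is zero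
  once its first m values are.\<close>

lemma krylov_zero:
  fixes A B :: "real mat"
  assumes A: "A \<in> carrier_mat n n" and B: "B \<in> carrier_mat r n" and v: "v \<in> carrier_vec n"
    and zero: "\<And>k. k < n \<Longrightarrow> B *\<^sub>v (A ^\<^sub>m k *\<^sub>v v) = 0\<^sub>v r"
  shows "B *\<^sub>v (A ^\<^sub>m k *\<^sub>v v) = 0\<^sub>v r"
proof (rule krylov_dependence[OF A v])
  fix u :: "nat \<Rightarrow> real" and m
  assume u: "m \<le> n" "u m \<noteq> 0"
    "\<And>q. q < n \<Longrightarrow> (\<Sum>j\<le>m. u j * (A ^\<^sub>m j *\<^sub>v v) $ q) = 0"
  show ?thesis
  proof (rule eq_vecI)
    fix a assume "a < dim_vec (0\<^sub>v r)"
    then have a: "a < r" by simp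
    define f where "f k = (B *\<^sub>v (A ^\<^sub>m k *\<^sub>v v)) $ a" for k
    \<comment> \<open>Row \<open>a\<close> of \<open>B * A^s\<close> is applied to the relation,
      which gives the recurrence at every offset \<open>s\<close>.\<close>
    have rec: "(\<Sum>j\<le>m. u j * f (s + j)) = 0" for s
    proof -
      define g where "g q = (B * A ^\<^sub>m s) $$ (a, q)" for q
      have "f (s + j) = (\<Sum>q<n. g q * (A ^\<^sub>m j *\<^sub>v v) $ q)" for j
      proof -
        have c: "A ^\<^sub>m s \<in> carrier_mat n n" "A ^\<^sub>m j \<in> carrier_mat n n"
          using A by simp_all
        have c': "A ^\<^sub>m j *\<^sub>v v \<in> carrier_vec n"
          using c v by simp
        define G where "G = B * A ^\<^sub>m s"
        have G: "G \<in> carrier_mat r n"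
          using B c unfolding G_def by simp
        have "f (s + j) = (G *\<^sub>v (A ^\<^sub>m j *\<^sub>v v)) $ a"
          unfolding f_def G_def pow_add_mult_mat_vec[OF A v] assoc_mult_mat_vec[OF B c(1) c'] ..
        then show ?thesis
          using a G c' unfolding g_def G_def[symmetric]
          by (simp add: scalar_prod_def atLeast0LessThan del: dim_mult_mat_vec)
      qed
      then have "(\<Sum>j\<le>m. u j * f (s + j)) = (\<Sum>j\<le>m. \<Sum>q<n. g q * (u j * (A ^\<^sub>m j *\<^sub>v v) $ q))"
        by (simp add: sum_distrib_left mult_ac)
      also have "\<dots> = (\<Sum>q<n. g q * (\<Sum>j\<le>m. u j * (A ^\<^sub>m j *\<^sub>v v) $ q))"
        by (subst sum.swap) (simp add: sum_distrib_left)
      finally show ?thesis using u(3) by simp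
    qed
    have "f k = 0"
    proof (induction k rule: less_induct)
      case (less k)
      show ?case
      proof (cases "k < m")
        case True
        then show ?thesis using zero[of k] u(1) a by (simp add: f_def)
      next
        \<comment> \<open>The offset \<open>k - m\<close> makes \<open>f k\<close> the leading term,
          and all other terms have an index below \<open>k\<close>.\<close>
        case False
        have "(\<Sum>j\<le>m. u j * f (k - m + j)) = (\<Sum>j<m. u j * f (k - m + j)) + u m * f k"
          using False by (simp add: lessThan_Suc_atMost[symmetric])
        moreover have "(\<Sum>j<m. u j * f (k - m + j)) = 0"
          using False by (intro sum.neutral) (auto intro!: less)
        ultimately show ?thesis using rec[of "k - m"] u(2) by simp
      qed
    qed
    then show "(B *\<^sub>v (A ^\<^sub>m k *\<^sub>v v)) $ a = 0\<^sub>v r $ a"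
      using a by (simp add: f_def)
  qed (use B in auto)
qed

text \<open>The bound in \<open>unobservable_space\<close> is the size of \<open>A\<close>. Without
  it, conditions for matrices of different sizes can be compared.\<close>

lemma unobservable_space_iff:
  fixes A C :: "real mat"
  assumes A: "A \<in> carrier_mat n n" and C: "C \<in> carrier_mat r n"
  shows "x \<in> unobservable_space C A \<longleftrightarrow>
    x \<in> carrier_vec n \<and> (\<forall>k. C *\<^sub>v (A ^\<^sub>m k *\<^sub>v x) = 0\<^sub>v r)"
proof -
  have "x \<in> mat_kernel (C * A ^\<^sub>m k) \<longleftrightarrow> C *\<^sub>v (A ^\<^sub>m k *\<^sub>v x) = 0\<^sub>v r"
    if x: "x \<in> carrier_vec n" for k
  proof -
    have "C * A ^\<^sub>m k \<in> carrier_mat r n"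
      using A C by simp
    then show ?thesis
      using x assoc_mult_mat_vec[OF C pow_carrier_mat[OF A] x] by (simp add: mat_kernel)
  qed
  then have "(\<forall>k<n. x \<in> mat_kernel (C * A ^\<^sub>m k)) \<longleftrightarrow> (\<forall>k. C *\<^sub>v (A ^\<^sub>m k *\<^sub>v x) = 0\<^sub>v r)"
    if "x \<in> carrier_vec n"
    using that krylov_zero[OF A C that] by auto
  then show ?thesis
    using A by (auto simp: unobservable_space_def)
qed

text \<open>If some \<open>r\<close> does not vanish at a vector \<open>e\<close> annihilated by the other functionals, then subtracting
  a multiple of \<open>r\<close> from \<open>v\<close> makes \<open>v\<close> vanish at \<open>e\<close>, and \<open>r\<close> can be dropped.\<close>

lemma annihilator_in_span:
  fixes F :: "real vec set"
  assumes "finite F" "F \<subseteq> carrier_vec n" "v \<in> carrier_vec n"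
    and "\<And>x. x \<in> carrier_vec n \<Longrightarrow> \<forall>r\<in>F. r \<bullet> x = 0 \<Longrightarrow> v \<bullet> x = 0"
    and "F \<subseteq> U" "0\<^sub>v n \<in> U"
    and add: "\<And>a b. a \<in> U \<Longrightarrow> b \<in> U \<Longrightarrow> a + b \<in> U"
    and smult: "\<And>c a. a \<in> U \<Longrightarrow> c \<cdot>\<^sub>v a \<in> U"
  shows "v \<in> U"
  using assms(1-5)
proof (induction F arbitrary: v rule: finite_induct)
  case empty
  have "v $ k = 0" if "k < n" for k
    using empty.prems(3)[of "unit_vec n k"] empty.prems(2) that by simp
  then have "v = 0\<^sub>v n"
    using empty.prems(2) by (intro eq_vecI) auto
  then show ?case using assms(6) by simp
next
  case (insert r F)
  have r: "r \<in> carrier_vec n" and F: "F \<subseteq> carrier_vec n" "F \<subseteq> U" and rU: "r \<in> U"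
    using insert.prems by auto
  note v = insert.prems(2)
  show ?case
  proof (cases "\<forall>x\<in>carrier_vec n. (\<forall>s\<in>F. s \<bullet> x = 0) \<longrightarrow> r \<bullet> x = 0")
    case True
    then show ?thesis
      using insert.prems(3) by (intro insert.IH[OF F(1) v _ F(2)]) auto
  next
    case False
    then obtain e where e: "e \<in> carrier_vec n" "\<forall>s\<in>F. s \<bullet> e = 0" "r \<bullet> e \<noteq> 0"
      by blast
    define c where "c = (v \<bullet> e) / (r \<bullet> e)"
    have v': "v + (- c) \<cdot>\<^sub>v r \<in> carrier_vec n"
      using v r by simp
    have "(v + (- c) \<cdot>\<^sub>v r) \<bullet> x = 0" if x: "x \<in> carrier_vec n" "\<forall>s\<in>F. s \<bullet> x = 0" for x
    proof -
      \<comment> \<open>Moving \<open>x\<close> along \<open>e\<close> makes \<open>r\<close> vanish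
        as well, while the members of \<open>F\<close> still vanish because they annihilate
        \<open>e\<close>. Hence the hypothesis on \<open>v\<close> applies to
        \<open>y\<close>.\<close>
      define y where "y = x + (- (r \<bullet> x) / (r \<bullet> e)) \<cdot>\<^sub>v e"
      have sy: "s \<bullet> y = s \<bullet> x - (r \<bullet> x) / (r \<bullet> e) * (s \<bullet> e)" if "s \<in> carrier_vec n" for s
        using that x e unfolding y_def by (simp add: scalar_prod_add_distrib[of _ n])
      have "v \<bullet> y = 0"
      proof (rule insert.prems(3))
        show "y \<in> carrier_vec n" using x e by (simp add: y_def)
        show "\<forall>s\<in>insert r F. s \<bullet> y = 0"
          using sy r F(1) x e by auto
      qed
      then have "v \<bullet> x = c * (r \<bullet> x)"
        using sy[OF v] by (simp add: c_def mult.commute)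
      then show ?thesis
        using v r x by (simp add: add_scalar_prod_distrib[of _ n])
    qed
    then have "v + (- c) \<cdot>\<^sub>v r \<in> U"
      by (intro insert.IH[OF F(1) v' _ F(2)]) auto
    then have "(v + (- c) \<cdot>\<^sub>v r) + c \<cdot>\<^sub>v r \<in> U"
      by (rule add[OF _ smult[OF rU]])
    also have "(v + (- c) \<cdot>\<^sub>v r) + c \<cdot>\<^sub>v r = v"
      using v r by (intro eq_vecI) auto
    finally show ?thesis .
  qed
qed

section \<open>Block index intervals and coordinate restriction\<close>

lemma block_inds_eq_UN: "block_inds n S = (\<Union>k\<in>S. block_inds n {k})"
  by (simp add: block_inds_def)

lemma block_inds_inj:
  assumes "a \<in> block_inds n {k}" "a \<in> block_inds n {l}"
  shows "k = l"
proof -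
  have "\<not> k < l" if "a \<in> block_inds n {k}" "a \<in> block_inds n {l}" for k l
  proof
    assume "k < l"
    then have "(\<Sum>i=1..k. n i) \<le> (\<Sum>i=1..<l. n i)"
      by (intro sum_mono2) auto
    then show False
      using that by (simp add: block_inds_def)
  qed
  then show ?thesis
    using assms by (meson linorder_neqE_nat)
qed

lemma block_inds_mem_iff: "a \<in> block_inds n {k} \<Longrightarrow> a \<in> block_inds n S \<longleftrightarrow> k \<in> S"
  using block_inds_inj by (subst block_inds_eq_UN) blast

lemma block_inds_subset:
  assumes "S \<subseteq> {1..p}"
  shows "block_inds n S \<subseteq> {..<total p n}"
proof -
  have "(\<Sum>l=1..k. n l) \<le> total p n" if "k \<in> S" for k
    unfolding total_def using that assms by (intro sum_mono2) auto
  then show ?thesis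
    unfolding block_inds_def by (force dest: less_le_trans)
qed

lemma block_inds_cover:
  assumes "a < total p n"
  obtains k where "k \<in> {1..p}" "a \<in> block_inds n {k}"
proof -
  have "\<exists>k\<in>{1..p}. a \<in> block_inds n {k}"
    using assms
  proof (induction p)
    case 0
    then show ?case by (simp add: total_def)
  next
    case (Suc p)
    show ?case
    proof (cases "a < total p n")
      case True
      then show ?thesis using Suc.IH by force
    next
      case False
      then have "a \<in> block_inds n {Suc p}"
        using Suc.prems by (simp add: total_def block_inds_def atLeastLessThanSuc_atLeastAtMost)
      then show ?thesis by auto
    qed
  qed
  then show ?thesis using that by blast
qed

lemma incidence_space_entry:
  assumes G: "G \<in> incidence_space p ge n m" and ij: "i \<in> {1..p}" "j \<in> {1..p}" "(j, i) \<notin> ge"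
    and a: "a \<in> block_inds n {i}" and b: "b \<in> block_inds m {j}"
  shows "G $$ (a, b) = 0"
proof -
  let ?I = "block_inds n {i}" and ?J = "block_inds m {j}"
  have car: "G \<in> carrier_mat (total p n) (total p m)"
    and sub: "submatrix G ?I ?J = 0\<^sub>m (n i) (m j)"
    using G ij by (auto simp: incidence_space_def block_submatrix_def)
  have I: "?I \<subseteq> {..<total p n}" and J: "?J \<subseteq> {..<total p m}"
    using ij by (auto intro!: block_inds_subset)
  have carS: "submatrix G ?I ?J \<in> carrier_mat (card ?I) (card ?J)"
    by (rule submatrix_carrier[OF car I J])
  have "finite ?I" "finite ?J"
    by (simp_all add: block_inds_def)
  then have "card {c \<in> ?I. c < a} < card ?I" "card {c \<in> ?J. c < b} < card ?J"
    using a b by (auto intro!: psubset_card_mono)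
  \<comment> \<open>The lengths of the two intervals are read off by comparing the dimensions of the
    submatrix with those of the zero block it equals.\<close>
  moreover have "card ?I = n i" "card ?J = m j"
    using carS unfolding sub by auto
  \<comment> \<open>The position of an entry inside the submatrix is given by the ranks of its row
    and column index.\<close>
  moreover have "G $$ (a, b) = submatrix G ?I ?J $$ (card {c \<in> ?I. c < a}, card {c \<in> ?J. c < b})"
    using a b I J car by (intro submatrix_index_card[symmetric]) auto
  ultimately show ?thesis
    by (simp add: sub)
qed

text \<open>Unlike \<open>subvector\<close>, this keeps the ambient dimension. For a block of
  coordinates it is the orthogonal projection onto the local state space, as
  \<open>orth_proj_local_space\<close> shows.\<close>

definition restrict_vec :: "real vec \<Rightarrow> nat set \<Rightarrow> real vec" where
  "restrict_vec x I = vec (dim_vec x) (\<lambda>k. if k \<in> I then x $ k else 0)"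

lemma restrict_vec_carrier [simp]: "restrict_vec x I \<in> carrier_vec n \<longleftrightarrow> x \<in> carrier_vec n"
  by (metis carrier_vecD carrier_vecI dim_vec restrict_vec_def)

lemma dim_restrict_vec [simp]: "dim_vec (restrict_vec x I) = dim_vec x"
  by (simp add: restrict_vec_def)

lemma index_restrict_vec [simp]:
  "k < dim_vec x \<Longrightarrow> restrict_vec x I $ k = (if k \<in> I then x $ k else 0)"
  by (simp add: restrict_vec_def)

text \<open>A coordinate projection is self-adjoint: both sides sum the products of entries over the
  indices in \<open>I\<close>.\<close>

lemma restrict_vec_scalar_prod:
  assumes "x \<in> carrier_vec n" "y \<in> carrier_vec n"
  shows "restrict_vec x I \<bullet> y = x \<bullet> restrict_vec y I"
  using assms by (auto simp: scalar_prod_def intro!: sum.cong)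

lemma restrict_vec_ident:
  "x \<in> carrier_vec n \<Longrightarrow> \<forall>k<n. k \<notin> I \<longrightarrow> x $ k = 0 \<Longrightarrow> restrict_vec x I = x"
  by (intro eq_vecI) auto

lemma mult_mat_vec_zero: "M \<in> carrier_mat r n \<Longrightarrow> M *\<^sub>v 0\<^sub>v n = 0\<^sub>v r"
  by (intro eq_vecI) auto

lemma finsum_vec_mem:
  assumes "finite F" "\<And>f. f \<in> F \<Longrightarrow> w f \<in> U" "U \<subseteq> carrier_vec n" "0\<^sub>v n \<in> U"
    and "\<And>a b. a \<in> U \<Longrightarrow> b \<in> U \<Longrightarrow> a + b \<in> U"
  shows "finsum_vec TYPE(real) n w F \<in> U"
  using assms(1,2)
proof (induction F rule: finite_induct)
  case empty
  then show ?case using assms(4) by (simp add: finsum_vec_empty)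
next
  case (insert f F)
  have "w f \<in> carrier_vec n" "w \<in> F \<rightarrow> carrier_vec n"
    using insert.prems assms(3) by auto
  then show ?case
    using insert.prems insert.IH assms(5) by (simp add: finsum_vec_insert[OF insert.hyps])
qed

section \<open>Causality of the output derivatives\<close>

locale causal_system =
  fixes \<Sigma> :: poset_system
  assumes causal: "poset_causal_system \<Sigma>"
begin

abbreviation "P \<equiv> {1..psize \<Sigma>}"
abbreviation "N \<equiv> xdim \<Sigma>"
abbreviation "R \<equiv> total (psize \<Sigma>) (ypart \<Sigma>)"
abbreviation "A \<equiv> matA \<Sigma>"
abbreviation "C \<equiv> matC \<Sigma>"
abbreviation "xblock S \<equiv> block_inds (xpart \<Sigma>) S"
abbreviation "yblock i \<equiv> block_inds (ypart \<Sigma>) {i}"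

text \<open>The \<open>k\<close>-th derivative at time 0 of the zero-input output with initial state \<open>x\<close>.\<close>

definition out_deriv :: "nat \<Rightarrow> real vec \<Rightarrow> real vec" where
  "out_deriv k x = C *\<^sub>v (A ^\<^sub>m k *\<^sub>v x)"

lemma A_carrier: "A \<in> carrier_mat N N" and C_carrier: "C \<in> carrier_mat R N"
  using causal by (auto simp: poset_causal_system_def incidence_space_def)

lemma pow_mult_carrier: "x \<in> carrier_vec N \<Longrightarrow> A ^\<^sub>m k *\<^sub>v x \<in> carrier_vec N"
  by (rule mult_mat_vec_carrier[OF pow_carrier_mat[OF A_carrier]])

lemma out_deriv_carrier: "x \<in> carrier_vec N \<Longrightarrow> out_deriv k x \<in> carrier_vec R"
  unfolding out_deriv_def by (rule mult_mat_vec_carrier[OF C_carrier pow_mult_carrier])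

lemma upset_subset: "upset \<Sigma> i \<subseteq> P" and downset_subset: "downset \<Sigma> i \<subseteq> P"
  by (auto simp: upset_def downset_def)

lemma self_mem_downset: "i \<in> P \<Longrightarrow> i \<in> downset \<Sigma> i"
  using causal
  by (auto simp: poset_causal_system_def partial_order_on_def preorder_on_def refl_on_def
      downset_def)

lemma mem_downset_iff: "i \<in> P \<Longrightarrow> j \<in> P \<Longrightarrow> i \<in> downset \<Sigma> j \<longleftrightarrow> j \<in> upset \<Sigma> i"
  by (auto simp: upset_def downset_def)

lemma xblock_subset: "S \<subseteq> P \<Longrightarrow> xblock S \<subseteq> {..<N}"
  by (rule block_inds_subset)

lemma yblock_subset: "i \<in> P \<Longrightarrow> yblock i \<subseteq> {..<R}"
  by (rule block_inds_subset) simp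

text \<open>A nonzero entry in block row k and block column j forces j above k. If k lies above i,
  transitivity puts j above i too.\<close>

lemma A_zero:
  assumes "a \<in> xblock (upset \<Sigma> i)" "b < N" "b \<notin> xblock (upset \<Sigma> i)"
  shows "A $$ (a, b) = 0"
proof -
  obtain k where k: "k \<in> upset \<Sigma> i" "a \<in> xblock {k}"
    using assms(1) by (subst (asm) block_inds_eq_UN) blast
  obtain j where j: "j \<in> P" "b \<in> xblock {j}"
    using block_inds_cover[OF assms(2)] .
  have "(j, i) \<notin> pord \<Sigma>"
    using assms(3) j block_inds_mem_iff[OF j(2)] by (simp add: upset_def)
  moreover have "(k, i) \<in> pord \<Sigma>" "trans (pord \<Sigma>)"
    using k(1) causal
    by (auto simp: upset_def poset_causal_system_def partial_order_on_def preorder_on_def)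
  ultimately have "(j, k) \<notin> pord \<Sigma>"
    by (meson transD)
  then show ?thesis
    using incidence_space_entry[of A _ _ _ _ k j a b] k j causal subsetD[OF upset_subset k(1)]
    by (auto simp: poset_causal_system_def)
qed

lemma C_zero:
  assumes "i \<in> P" "a \<in> yblock i" "b < N" "b \<notin> xblock (upset \<Sigma> i)"
  shows "C $$ (a, b) = 0"
proof -
  obtain j where j: "j \<in> P" "b \<in> xblock {j}"
    using block_inds_cover[OF assms(3)] .
  have "(j, i) \<notin> pord \<Sigma>"
    using assms(4) j block_inds_mem_iff[OF j(2)] by (simp add: upset_def)
  then show ?thesis
    using incidence_space_entry[of C _ _ _ _ i j a b] assms j causal
    by (auto simp: poset_causal_system_def)
qed

text \<open>Both zero patterns confine the relevant rows of \<open>A\<close> and \<open>C\<close> to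
  the columns in \<open>I\<close>, so selecting coordinates commutes with each factor of the
  product.\<close>

lemma subvector_out_deriv:
  assumes i: "i \<in> P" and x: "x \<in> carrier_vec N"
  defines "I \<equiv> xblock (upset \<Sigma> i)"
  shows "submatrix C (yblock i) I *\<^sub>v (submatrix A I I ^\<^sub>m k *\<^sub>v subvector x I)
    = subvector (out_deriv k x) (yblock i)"
proof -
  have I: "I \<subseteq> {..<N}"
    unfolding I_def by (rule xblock_subset[OF upset_subset])
  have "submatrix A I I ^\<^sub>m k *\<^sub>v subvector x I = subvector (A ^\<^sub>m k *\<^sub>v x) I"
    by (rule submatrix_pow_mult_subvector[OF A_carrier x I]) (simp add: I_def A_zero)
  moreover have "submatrix C (yblock i) I *\<^sub>v subvector (A ^\<^sub>m k *\<^sub>v x) I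
      = subvector (C *\<^sub>v (A ^\<^sub>m k *\<^sub>v x)) (yblock i)"
    by (rule submatrix_mult_subvector[OF C_carrier pow_mult_carrier[OF x] yblock_subset[OF i] I])
      (simp add: I_def C_zero[OF i])
  ultimately show ?thesis
    by (simp add: out_deriv_def)
qed

text \<open>By \<open>subvector_out_deriv\<close>, output block i sees the state only through its
  upstream coordinates. Later this allows replacing a state by zero or by its upstream
  truncation.\<close>

lemma out_deriv_eq_upstream:
  assumes i: "i \<in> P" and x: "x \<in> carrier_vec N" and y: "y \<in> carrier_vec N"
    and eq: "\<And>b. b \<in> xblock (upset \<Sigma> i) \<Longrightarrow> x $ b = y $ b" and a: "a \<in> yblock i"
  shows "out_deriv k x $ a = out_deriv k y $ a"
proof -
  have "subvector x (xblock (upset \<Sigma> i)) = subvector y (xblock (upset \<Sigma> i))"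
    using subvector_eq_iff[OF x y xblock_subset[OF upset_subset]] eq by blast
  then have "subvector (out_deriv k x) (yblock i) = subvector (out_deriv k y) (yblock i)"
    using subvector_out_deriv[OF i x] subvector_out_deriv[OF i y] by metis
  then show ?thesis
    using subvector_eq_iff[OF out_deriv_carrier[OF x] out_deriv_carrier[OF y] yblock_subset[OF i]] a
    by blast
qed

lemma unobs_iff: "x \<in> unobs \<Sigma> \<longleftrightarrow> x \<in> carrier_vec N \<and> (\<forall>k. out_deriv k x = 0\<^sub>v R)"
  unfolding unobs_def unobservable_space_iff[OF A_carrier C_carrier] out_deriv_def ..

text \<open>Each upstream indistinguishable set constrains a single output block, so the full
  condition is split in the same way.\<close>

lemma unobs_iff_blocks:
  "x \<in> unobs \<Sigma> \<longleftrightarrow> x \<in> carrier_vec N \<and> (\<forall>i\<in>P. \<forall>k. \<forall>a\<in>yblock i. out_deriv k x $ a = 0)"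
proof -
  have "out_deriv k x = 0\<^sub>v R \<longleftrightarrow> (\<forall>i\<in>P. \<forall>a\<in>yblock i. out_deriv k x $ a = 0)"
    if x: "x \<in> carrier_vec N" for k
  proof
    assume "out_deriv k x = 0\<^sub>v R"
    then show "\<forall>i\<in>P. \<forall>a\<in>yblock i. out_deriv k x $ a = 0"
      using yblock_subset by fastforce
  next
    assume *: "\<forall>i\<in>P. \<forall>a\<in>yblock i. out_deriv k x $ a = 0"
    have "out_deriv k x $ a = 0" if "a < R" for a
      using block_inds_cover[OF that] * by blast
    then show "out_deriv k x = 0\<^sub>v R"
      using out_deriv_carrier[OF x, of k] by (intro eq_vecI) auto
  qed
  then show ?thesis
    unfolding unobs_iff by blast
qed

lemma zero_mem_unobs: "0\<^sub>v N \<in> unobs \<Sigma>"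
proof -
  have "out_deriv k (0\<^sub>v N) = 0\<^sub>v R" for k
    unfolding out_deriv_def mult_mat_vec_zero[OF pow_carrier_mat[OF A_carrier]]
    by (rule mult_mat_vec_zero[OF C_carrier])
  then show ?thesis
    by (simp add: unobs_iff)
qed

lemma add_mem_unobs:
  assumes "x \<in> unobs \<Sigma>" "y \<in> unobs \<Sigma>"
  shows "x + y \<in> unobs \<Sigma>"
proof -
  have c: "x \<in> carrier_vec N" "y \<in> carrier_vec N"
    using assms by (simp_all add: unobs_iff)
  have "out_deriv k (x + y) = out_deriv k x + out_deriv k y" for k
    unfolding out_deriv_def mult_add_distrib_mat_vec[OF pow_carrier_mat[OF A_carrier] c]
    by (rule mult_add_distrib_mat_vec[OF C_carrier pow_mult_carrier[OF c(1)] pow_mult_carrier[OF c(2)]])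
  then show ?thesis
    using assms by (simp add: unobs_iff)
qed

section \<open>Coordinate descriptions of local spaces, sums and projections\<close>

lemma local_space_iff:
  "x \<in> local_space \<Sigma> j \<longleftrightarrow> x \<in> carrier_vec N \<and> (\<forall>k<N. k \<notin> xblock {j} \<longrightarrow> x $ k = 0)"
  by (simp add: local_space_def state_space_def)

lemma restrict_mem_local_space: "x \<in> carrier_vec N \<Longrightarrow> restrict_vec x (xblock {j}) \<in> local_space \<Sigma> j"
  by (simp add: local_space_iff)

lemma restrict_local_space: "x \<in> local_space \<Sigma> j \<Longrightarrow> restrict_vec x (xblock {j}) = x"
  using restrict_vec_ident[of x N] by (simp add: local_space_iff)

text \<open>The local spaces are supported on disjoint index blocks, so the summands of
  \<open>x\<close> can only be its restrictions to the blocks. This removes the existential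
  quantifier from \<open>orth_sum\<close>.\<close>

lemma orth_sum_iff:
  assumes S: "S \<subseteq> P" and W: "\<And>j. j \<in> S \<Longrightarrow> W j \<subseteq> local_space \<Sigma> j"
  shows "x \<in> orth_sum \<Sigma> S W \<longleftrightarrow> x \<in> carrier_vec N \<and>
    (\<forall>j\<in>S. restrict_vec x (xblock {j}) \<in> W j) \<and> (\<forall>k<N. k \<notin> xblock S \<longrightarrow> x $ k = 0)"
    (is "_ \<longleftrightarrow> ?rhs")
proof
  have fin: "finite S"
    using S finite_subset by blast
  {
    assume "x \<in> orth_sum \<Sigma> S W"
    then obtain w where x: "x = finsum_vec TYPE(real) N w S" and w: "\<And>j. j \<in> S \<Longrightarrow> w j \<in> W j"
      by (auto simp: orth_sum_def)
    have wl: "w j \<in> local_space \<Sigma> j" if "j \<in> S" for j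
      using w W that by blast
    then have wc: "w \<in> S \<rightarrow> carrier_vec N"
      by (auto simp: local_space_iff)
    have xc: "x \<in> carrier_vec N"
      unfolding x using wc by (rule finsum_vec_closed)
    have idx: "x $ k = (\<Sum>j\<in>S. w j $ k)" if "k < N" for k
      unfolding x by (rule index_finsum_vec[OF fin that wc])
    have "x $ k = 0" if "k < N" "k \<notin> xblock S" for k
    proof -
      have "w j $ k = 0" if "j \<in> S" for j
        using wl[OF that] \<open>k < N\<close> \<open>k \<notin> xblock S\<close> that block_inds_mem_iff[of k _ j S]
        by (auto simp: local_space_iff)
      then show ?thesis using idx[OF that(1)] by simp
    qed
    moreover have "restrict_vec x (xblock {j}) = w j" if j: "j \<in> S" for j
    proof (rule eq_vecI)
      have wj: "w j \<in> carrier_vec N"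
        using wl[OF j] by (simp add: local_space_iff)
      then show "dim_vec (restrict_vec x (xblock {j})) = dim_vec (w j)"
        using xc wj by simp
      fix k assume "k < dim_vec (w j)"
      then have k: "k < N"
        using wj by simp
      show "restrict_vec x (xblock {j}) $ k = w j $ k"
      proof (cases "k \<in> xblock {j}")
        case True
        \<comment> \<open>In a coordinate of block j every other summand vanishes.\<close>
        have "w l $ k = 0" if "l \<in> S - {j}" for l
          using that wl[of l] k block_inds_inj[OF True, of l] by (auto simp: local_space_iff)
        then have "x $ k = w j $ k"
          using j fin by (simp add: idx[OF k] sum.remove)
        then show ?thesis
          using True k xc by simp
      next
        case False
        then show ?thesis
          using k xc wl[OF j] by (simp add: local_space_iff)
      qed
    qed
    ultimately show ?rhs
      using xc w by simp
  }
  {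
    assume rhs: ?rhs
    let ?w = "\<lambda>j. restrict_vec x (xblock {j})"
    have wc: "?w \<in> S \<rightarrow> carrier_vec N"
      using rhs by simp
    have "x = finsum_vec TYPE(real) N ?w S"
    proof (rule eq_vecI)
      have fc: "finsum_vec TYPE(real) N ?w S \<in> carrier_vec N"
        using wc by (rule finsum_vec_closed)
      then show "dim_vec x = dim_vec (finsum_vec TYPE(real) N ?w S)"
        using rhs by (metis carrier_vecD)
      fix k assume "k < dim_vec (finsum_vec TYPE(real) N ?w S)"
      then have k: "k < N"
        using fc by simp
      then obtain l where l: "k \<in> xblock {l}"
        by (rule block_inds_cover)
      have "finsum_vec TYPE(real) N ?w S $ k = (\<Sum>j\<in>S. ?w j $ k)"
        by (rule index_finsum_vec[OF fin k wc])
      also have "\<dots> = (\<Sum>j\<in>S. if j = l then x $ k else 0)"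
        using k rhs block_inds_mem_iff[OF l] by (intro sum.cong) auto
      \<comment> \<open>If the block \<open>l\<close> containing \<open>k\<close> is not in
        \<open>S\<close>, the sum is zero, and so is \<open>x $ k\<close> by the support
        condition.\<close>
      also have "\<dots> = x $ k"
        using rhs k fin block_inds_mem_iff[OF l, of S] by auto
      finally show "x $ k = finsum_vec TYPE(real) N ?w S $ k" ..
    qed
    then show "x \<in> orth_sum \<Sigma> S W"
      using rhs by (auto simp: orth_sum_def)
  }
qed

lemma orth_sum_P_iff:
  assumes "\<And>j. j \<in> P \<Longrightarrow> W j \<subseteq> local_space \<Sigma> j"
  shows "x \<in> orth_sum \<Sigma> P W \<longleftrightarrow>
    x \<in> carrier_vec N \<and> (\<forall>j\<in>P. restrict_vec x (xblock {j}) \<in> W j)"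
proof -
  have "k \<in> xblock P" if k: "k < N" for k
  proof -
    obtain j where "j \<in> P" "k \<in> xblock {j}"
      using block_inds_cover[OF k] .
    then show ?thesis
      using block_inds_mem_iff[of k _ j P] by simp
  qed
  then show ?thesis
    using orth_sum_iff[OF order_refl assms] by simp
qed

lemma local_sum_iff:
  assumes "S \<subseteq> P"
  shows "x \<in> local_sum \<Sigma> S \<longleftrightarrow>
    x \<in> carrier_vec N \<and> (\<forall>k<N. k \<notin> xblock S \<longrightarrow> x $ k = 0)"
  unfolding local_sum_def orth_sum_iff[OF assms order_refl]
  by (auto simp: restrict_mem_local_space)

text \<open>The submatrices are traded for the full \<open>A\<close> and \<open>C\<close>, so that
  all indistinguishable sets are expressed by the same derivatives as \<open>unobs\<close>.\<close>

lemma upstream_indist_iff: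
  assumes i: "i \<in> P"
  shows "x \<in> upstream_indist \<Sigma> i \<longleftrightarrow>
    x \<in> local_sum \<Sigma> (upset \<Sigma> i) \<and> (\<forall>k. \<forall>a\<in>yblock i. out_deriv k x $ a = 0)"
proof -
  define I where "I = xblock (upset \<Sigma> i)"
  have I: "I \<subseteq> {..<N}"
    unfolding I_def by (rule xblock_subset[OF upset_subset])
  note Y = yblock_subset[OF i]
  have "subvector x I \<in> unobservable_space (submatrix C (yblock i) I) (submatrix A I I) \<longleftrightarrow>
      (\<forall>k. \<forall>a\<in>yblock i. out_deriv k x $ a = 0)" if x: "x \<in> carrier_vec N"
    unfolding unobservable_space_iff[OF submatrix_carrier[OF A_carrier I I]
        submatrix_carrier[OF C_carrier Y I]]
      subvector_out_deriv[OF i x, folded I_def] subvector_eq_0_iff[OF out_deriv_carrier[OF x] Y]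
    using carrier_vecI[OF dim_subvector[OF x I]] by blast
  then show ?thesis
    using local_sum_iff[OF upset_subset]
    unfolding upstream_indist_def block_submatrix_def I_def[symmetric] by blast
qed

lemma orth_proj_local_space:
  assumes x: "x \<in> carrier_vec N"
  shows "orth_proj (local_space \<Sigma> j) x = restrict_vec x (xblock {j})"
  unfolding orth_proj_def
proof (rule the_equality)
  have "(x - restrict_vec x (xblock {j})) \<bullet> w = 0" if "w \<in> local_space \<Sigma> j" for w
    using that x by (auto simp: scalar_prod_def local_space_iff intro!: sum.neutral)
  then show "restrict_vec x (xblock {j}) \<in> local_space \<Sigma> j \<and>
      (\<forall>w\<in>local_space \<Sigma> j. (x - restrict_vec x (xblock {j})) \<bullet> w = 0)"
    using restrict_mem_local_space[OF x] by blast
next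
  fix v assume v: "v \<in> local_space \<Sigma> j \<and> (\<forall>w\<in>local_space \<Sigma> j. (x - v) \<bullet> w = 0)"
  then have vc: "v \<in> carrier_vec N"
    by (simp add: local_space_iff)
  show "v = restrict_vec x (xblock {j})"
  proof (rule eq_vecI)
    fix k assume "k < dim_vec (restrict_vec x (xblock {j}))"
    then have k: "k < N" using x by simp
    show "v $ k = restrict_vec x (xblock {j}) $ k"
    proof (cases "k \<in> xblock {j}")
      case True
      \<comment> \<open>Uniqueness in the definite description: testing orthogonality against the
        unit vectors of the block determines each entry there.\<close>
      then have "unit_vec N k \<in> local_space \<Sigma> j"
        by (auto simp: local_space_iff unit_vec_def)
      then have "(x - v) \<bullet> unit_vec N k = 0"
        using v by blast
      then have "x $ k - v $ k = 0"
        using k x vc by (simp add: scalar_prod_right_unit)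
      then show ?thesis
        using True k x by simp
    next
      case False
      then show ?thesis
        using k x v by (simp add: local_space_iff)
    qed
  qed (use x vc in simp)
qed

lemma local_proj_eq:
  "W \<subseteq> carrier_vec N \<Longrightarrow> local_proj \<Sigma> j W = (\<lambda>x. restrict_vec x (xblock {j})) ` W"
  unfolding local_proj_def by (intro image_cong refl orth_proj_local_space) blast

section \<open>Comparison of the structured subspaces with the unobservable subspace\<close>

lemma unobs_carrier: "unobs \<Sigma> \<subseteq> carrier_vec N"
  by (auto simp: unobs_iff)

lemma upstream_indist_carrier: "i \<in> P \<Longrightarrow> upstream_indist \<Sigma> i \<subseteq> carrier_vec N"
  using local_sum_iff[OF upset_subset] by (auto simp: upstream_indist_iff)

text \<open>For i below j, the sets in the intersection control output block i. For any other i,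
  block j is not upstream of i, so a state supported on block j has zero output block i.\<close>

lemma Nbar_loc_eq:
  assumes j: "j \<in> P"
  shows "Nbar_loc \<Sigma> j = local_space \<Sigma> j \<inter> unobs \<Sigma>"
proof (intro subset_antisym subsetI)
  fix x assume x: "x \<in> Nbar_loc \<Sigma> j"
  \<comment> \<open>Membership in the local space can be extracted only because the intersection has
    a nonempty index set: j lies in its own down-set.\<close>
  then have xl: "x \<in> local_space \<Sigma> j"
    and up: "\<And>i. i \<in> downset \<Sigma> j \<Longrightarrow> x \<in> upstream_indist \<Sigma> i"
    using self_mem_downset[OF j] unfolding Nbar_loc_def by blast+
  then have xc: "x \<in> carrier_vec N"
    by (simp add: local_space_iff)
  have "out_deriv k x $ a = 0" if i: "i \<in> P" and a: "a \<in> yblock i" for i k a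
  proof (cases "i \<in> downset \<Sigma> j")
    case True
    then show ?thesis
      using up a upstream_indist_iff[OF i] by blast
  next
    case False
    then have j': "j \<notin> upset \<Sigma> i"
      using mem_downset_iff[OF i j] by simp
    have "x $ b = 0\<^sub>v N $ b" if b: "b \<in> xblock (upset \<Sigma> i)" for b
    proof -
      have "b < N"
        using b xblock_subset[OF upset_subset] by blast
      moreover have "b \<notin> xblock {j}"
        using b j' block_inds_mem_iff[of b _ j "upset \<Sigma> i"] by blast
      ultimately show ?thesis
        using xl by (simp add: local_space_iff)
    qed
    \<comment> \<open>On the upstream coordinates of i the state agrees with the zero vector, which
      is unobservable.\<close>
    then have "out_deriv k x $ a = out_deriv k (0\<^sub>v N) $ a"
      by (intro out_deriv_eq_upstream[OF i xc _ _ a]) auto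
    then show ?thesis
      using zero_mem_unobs i a by (simp add: unobs_iff_blocks)
  qed
  then show "x \<in> local_space \<Sigma> j \<inter> unobs \<Sigma>"
    using xl xc by (simp add: unobs_iff_blocks)
next
  fix x assume x: "x \<in> local_space \<Sigma> j \<inter> unobs \<Sigma>"
  have "x \<in> upstream_indist \<Sigma> i" if "i \<in> downset \<Sigma> j" for i
  proof -
    have i: "i \<in> P"
      using that downset_subset by blast
    have "j \<in> upset \<Sigma> i"
      using mem_downset_iff[OF i j] that by simp
    then have "b \<notin> xblock {j}" if "b \<notin> xblock (upset \<Sigma> i)" for b
      using that block_inds_mem_iff[of b _ j "upset \<Sigma> i"] by blast
    then have "x \<in> local_sum \<Sigma> (upset \<Sigma> i)"
      using x by (simp add: local_sum_iff[OF upset_subset] local_space_iff)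
    then show ?thesis
      using x i by (simp add: upstream_indist_iff unobs_iff_blocks)
  qed
  then show "x \<in> Nbar_loc \<Sigma> j"
    using x by (auto simp: Nbar_loc_def)
qed

lemma Ncirc_loc_subset: "Ncirc_loc \<Sigma> j \<subseteq> local_space \<Sigma> j"
  using restrict_mem_local_space by (auto simp: Ncirc_loc_def local_proj_eq unobs_carrier unobs_iff)

text \<open>Truncating an unobservable state to the coordinates upstream of i leaves output block i
  unchanged, so the result is i-upstream indistinguishable. It has the same component j, since j is
  upstream of i.\<close>

lemma Ncirc_loc_subset_Ntilde_loc:
  assumes j: "j \<in> P"
  shows "Ncirc_loc \<Sigma> j \<subseteq> Ntilde_loc \<Sigma> j"
  unfolding Ncirc_loc_def Ntilde_loc_def
proof (intro INT_greatest subsetI)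
  fix i z assume i': "i \<in> downset \<Sigma> j" and "z \<in> local_proj \<Sigma> j (unobs \<Sigma>)"
  then obtain x where x: "x \<in> unobs \<Sigma>" "z = restrict_vec x (xblock {j})"
    by (auto simp: local_proj_eq[OF unobs_carrier])
  have i: "i \<in> P"
    using i' downset_subset by blast
  then have ju: "j \<in> upset \<Sigma> i"
    using i' mem_downset_iff j by blast
  have xc: "x \<in> carrier_vec N"
    using x(1) by (simp add: unobs_iff)
  let ?y = "restrict_vec x (xblock (upset \<Sigma> i))"
  have "out_deriv k ?y $ a = 0" if a: "a \<in> yblock i" for k a
  proof -
    have "?y $ b = x $ b" if "b \<in> xblock (upset \<Sigma> i)" for b
    proof -
      have "b < dim_vec x"
        using that xblock_subset[OF upset_subset] xc by auto
      then show ?thesis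
        using that by simp
    qed
    then have "out_deriv k ?y $ a = out_deriv k x $ a"
      using xc by (intro out_deriv_eq_upstream[OF i _ _ _ a]) auto
    then show ?thesis
      using x(1) i a by (simp add: unobs_iff_blocks)
  qed
  then have "?y \<in> upstream_indist \<Sigma> i"
    using xc by (simp add: upstream_indist_iff[OF i] local_sum_iff[OF upset_subset])
  moreover have "z = restrict_vec ?y (xblock {j})"
    unfolding x(2) using ju block_inds_mem_iff[of _ _ j "upset \<Sigma> i"]
    by (intro eq_vecI) auto
  ultimately show "z \<in> local_proj \<Sigma> j (upstream_indist \<Sigma> i)"
    unfolding local_proj_eq[OF upstream_indist_carrier[OF i]] by blast
qed

lemma Nbar_loc_subset: "j \<in> P \<Longrightarrow> Nbar_loc \<Sigma> j \<subseteq> local_space \<Sigma> j"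
  by (simp add: Nbar_loc_eq)

lemma Nbar_iff:
  "x \<in> Nbar \<Sigma> \<longleftrightarrow> x \<in> carrier_vec N \<and> (\<forall>j\<in>P. restrict_vec x (xblock {j}) \<in> unobs \<Sigma>)"
proof -
  have "x \<in> Nbar \<Sigma> \<longleftrightarrow>
      x \<in> carrier_vec N \<and> (\<forall>j\<in>P. restrict_vec x (xblock {j}) \<in> Nbar_loc \<Sigma> j)"
    unfolding Nbar_def by (intro orth_sum_P_iff Nbar_loc_subset)
  then show ?thesis
    using Nbar_loc_eq restrict_mem_local_space by blast
qed

lemma Ncirc_iff:
  "x \<in> Ncirc \<Sigma> \<longleftrightarrow> x \<in> carrier_vec N \<and> (\<forall>j\<in>P. restrict_vec x (xblock {j}) \<in> Ncirc_loc \<Sigma> j)"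
  unfolding Ncirc_def by (rule orth_sum_P_iff[OF Ncirc_loc_subset])

lemma Nbar_subset_unobs: "Nbar \<Sigma> \<subseteq> unobs \<Sigma>"
proof
  fix x assume "x \<in> Nbar \<Sigma>"
  then obtain w where "x = finsum_vec TYPE(real) N w P" "\<forall>j\<in>P. w j \<in> unobs \<Sigma>"
    by (auto simp: Nbar_def orth_sum_def Nbar_loc_eq)
  then show "x \<in> unobs \<Sigma>"
    using finsum_vec_mem[OF _ _ unobs_carrier zero_mem_unobs add_mem_unobs, of P w] by simp
qed

lemma unobs_subset_Ncirc: "unobs \<Sigma> \<subseteq> Ncirc \<Sigma>"
  by (auto simp: Ncirc_iff Ncirc_loc_def local_proj_eq[OF unobs_carrier] unobs_iff)

lemma Ncirc_subset_Ntilde: "Ncirc \<Sigma> \<subseteq> Ntilde \<Sigma>"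
  using Ncirc_loc_subset_Ntilde_loc
  unfolding Ntilde_def Ncirc_def orth_sum_def by blast

text \<open>One inclusion is self-adjointness of the projection. The other applies
  \<open>annihilator_in_span\<close> to finitely many projected rows of the observability matrix,
  with the projected complement as the closed set \<open>U\<close>.\<close>

lemma local_proj_perp_unobs:
  assumes j: "j \<in> P"
  shows "local_proj \<Sigma> j (perp \<Sigma> (unobs \<Sigma>)) = local_space \<Sigma> j \<ominus>\<^sub>v Nbar_loc \<Sigma> j"
proof -
  let ?r = "\<lambda>x. restrict_vec x (xblock {j})"
  let ?U = "?r ` perp \<Sigma> (unobs \<Sigma>)"
  have perp_iff: "u \<in> perp \<Sigma> (unobs \<Sigma>) \<longleftrightarrow> u \<in> carrier_vec N \<and> (\<forall>x\<in>unobs \<Sigma>. u \<bullet> x = 0)" for u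
    by (simp add: perp_def ominus_def state_space_def)
  have perp_carrier: "perp \<Sigma> (unobs \<Sigma>) \<subseteq> carrier_vec N"
    by (auto simp: perp_iff)
  have "?U \<subseteq> local_space \<Sigma> j \<ominus>\<^sub>v Nbar_loc \<Sigma> j"
  proof
    fix v assume "v \<in> ?U"
    then obtain u where u: "u \<in> perp \<Sigma> (unobs \<Sigma>)" and v: "v = ?r u"
      by blast
    have uc: "u \<in> carrier_vec N"
      using u by (simp add: perp_iff)
    have "v \<bullet> x = 0" if "x \<in> local_space \<Sigma> j" "x \<in> unobs \<Sigma>" for x
      using that u uc restrict_vec_scalar_prod[OF uc, of x "xblock {j}"] restrict_local_space[of x j]
      by (simp add: v perp_iff unobs_iff)
    then show "v \<in> local_space \<Sigma> j \<ominus>\<^sub>v Nbar_loc \<Sigma> j"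
      using restrict_mem_local_space[OF uc] by (simp add: v ominus_def Nbar_loc_eq[OF j])
  qed
  moreover have "local_space \<Sigma> j \<ominus>\<^sub>v Nbar_loc \<Sigma> j \<subseteq> ?U"
  proof
    fix v assume "v \<in> local_space \<Sigma> j \<ominus>\<^sub>v Nbar_loc \<Sigma> j"
    then have vl: "v \<in> local_space \<Sigma> j"
      and vperp: "\<And>x. x \<in> local_space \<Sigma> j \<Longrightarrow> x \<in> unobs \<Sigma> \<Longrightarrow> v \<bullet> x = 0"
      by (auto simp: ominus_def Nbar_loc_eq[OF j])
    have vc: "v \<in> carrier_vec N"
      using vl by (simp add: local_space_iff)
    \<comment> \<open>The rows of the observability matrix: the scalar product with
      \<open>rw (k, a)\<close> is entry \<open>a\<close> of the \<open>k\<close>-th output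
      derivative.\<close>
    define rw where "rw = (\<lambda>(k, a). row (C * A ^\<^sub>m k) a)"
    have M: "C * A ^\<^sub>m k \<in> carrier_mat R N" for k
      using A_carrier C_carrier by simp
    have rw_carrier: "rw (k, a) \<in> carrier_vec N" for k a
      using row_carrier[of "C * A ^\<^sub>m k" a] carrier_matD(2)[OF M[of k]] by (simp only: rw_def case_prod_conv)
    have rw_prod: "rw (k, a) \<bullet> x = out_deriv k x $ a" if "x \<in> carrier_vec N" "a < R" for k a x
      using that M[of k] assoc_mult_mat_vec[OF C_carrier pow_carrier_mat[OF A_carrier] that(1), of k]
      unfolding rw_def out_deriv_def by (metis carrier_matD(1) case_prod_conv index_mult_mat_vec)
    let ?F = "(\<lambda>ka. ?r (rw ka)) ` ({..<N} \<times> {..<R})"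
    show "v \<in> ?U"
    proof (rule annihilator_in_span[of ?F N])
      fix x assume x: "x \<in> carrier_vec N" "\<forall>r\<in>?F. r \<bullet> x = 0"
      have rx: "?r x \<in> carrier_vec N"
        using x by simp
      \<comment> \<open>The projection moves from the row to \<open>x\<close>, so annihilation by
        \<open>?F\<close> says that the projected state has zero derivatives of order below
        \<open>N\<close>.\<close>
      have "out_deriv k (?r x) $ a = 0" if "k < N" "a < R" for k a
        using x(2) that rw_prod[OF rx that(2), of k]
          restrict_vec_scalar_prod[OF rw_carrier x(1), of k a "xblock {j}"] by force
      then have "out_deriv k (?r x) = 0\<^sub>v R" if "k < N" for k
        using out_deriv_carrier[OF rx, of k] that by (intro eq_vecI) auto
      \<comment> \<open>\<open>?F\<close> has to be finite and so stops at \<open>N\<close>;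
        \<open>krylov_zero\<close> supplies the higher orders.\<close>
      then have "?r x \<in> unobs \<Sigma>"
        using krylov_zero[OF A_carrier C_carrier rx] rx by (simp add: unobs_iff out_deriv_def)
      then have "v \<bullet> ?r x = 0"
        by (rule vperp[OF restrict_mem_local_space[OF x(1)]])
      then show "v \<bullet> x = 0"
        using restrict_vec_scalar_prod[OF vc x(1), of "xblock {j}"] restrict_local_space[OF vl]
        by simp
    next
      show "?F \<subseteq> ?U"
      proof
        fix r assume "r \<in> ?F"
        then obtain k a where "a < R" and r: "r = ?r (rw (k, a))"
          by auto
        \<comment> \<open>Pairing with an unobservable state gives an entry of a zero
          derivative.\<close>
        then have "rw (k, a) \<in> perp \<Sigma> (unobs \<Sigma>)"
          using rw_carrier rw_prod by (simp add: perp_iff unobs_iff)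
        then show "r \<in> ?U"
          unfolding r by blast
      qed
    next
      have "0\<^sub>v N = ?r (0\<^sub>v N)"
        by (intro eq_vecI) auto
      moreover have "0\<^sub>v N \<in> perp \<Sigma> (unobs \<Sigma>)"
        by (simp add: perp_iff unobs_iff)
      ultimately show "0\<^sub>v N \<in> ?U"
        by blast
    next
      fix a b assume "a \<in> ?U" "b \<in> ?U"
      then obtain s t where st: "s \<in> perp \<Sigma> (unobs \<Sigma>)" "a = ?r s" "t \<in> perp \<Sigma> (unobs \<Sigma>)" "b = ?r t"
        by blast
      then have "s + t \<in> perp \<Sigma> (unobs \<Sigma>)"
        by (simp add: perp_iff unobs_iff add_scalar_prod_distrib[of _ N])
      moreover have "a + b = ?r (s + t)"
        using st by (intro eq_vecI) (auto simp: perp_iff)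
      ultimately show "a + b \<in> ?U"
        by blast
    next
      fix c a assume "a \<in> ?U"
      then obtain s where s: "s \<in> perp \<Sigma> (unobs \<Sigma>)" "a = ?r s"
        by blast
      then have "c \<cdot>\<^sub>v s \<in> perp \<Sigma> (unobs \<Sigma>)"
        using unobs_carrier by (auto simp: perp_iff smult_scalar_prod_distrib[of _ N])
      moreover have "c \<cdot>\<^sub>v a = ?r (c \<cdot>\<^sub>v s)"
        using s by (intro eq_vecI) auto
      ultimately show "c \<cdot>\<^sub>v a \<in> ?U"
        by blast
    qed (use vc rw_carrier in auto)
  qed
  ultimately show ?thesis
    unfolding local_proj_eq[OF perp_carrier] by blast
qed

section \<open>Extremality of the inner and outer sums, and the theorem\<close>

lemma perp_antimono: "V \<subseteq> W \<Longrightarrow> perp \<Sigma> W \<subseteq> perp \<Sigma> V"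
  by (auto simp: perp_def ominus_def)

lemma zero_mem_subspace: "is_subspace \<Sigma> W \<Longrightarrow> 0\<^sub>v N \<in> W"
  unfolding is_subspace_def VectorSpace.subspace_def
  by (auto dest: submodule.zero_closed simp: module_vec_simps)

lemma zero_mem_Nbar: "0\<^sub>v N \<in> Nbar \<Sigma>"
proof -
  have "restrict_vec (0\<^sub>v N) I = 0\<^sub>v N" for I
    by (intro eq_vecI) auto
  then show ?thesis
    using zero_mem_unobs by (simp add: Nbar_iff)
qed

text \<open>Each component of an element of the sum, completed by zeros in the other local spaces,
  is again in the sum and therefore unobservable by itself. By \<open>Nbar_iff\<close> this is what
  \<open>Nbar\<close> asks for.\<close>

lemma orth_sum_subset_Nbar:
  assumes Q: "\<And>j. j \<in> P \<Longrightarrow> is_subspace \<Sigma> (Q j) \<and> Q j \<subseteq> local_space \<Sigma> j"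
    and sub: "orth_sum \<Sigma> P Q \<subseteq> unobs \<Sigma>"
  shows "orth_sum \<Sigma> P Q \<subseteq> Nbar \<Sigma>"
proof
  have Qsub: "Q j \<subseteq> local_space \<Sigma> j" if "j \<in> P" for j
    using Q that by blast
  have iff: "y \<in> orth_sum \<Sigma> P Q \<longleftrightarrow>
      y \<in> carrier_vec N \<and> (\<forall>j\<in>P. restrict_vec y (xblock {j}) \<in> Q j)" for y
    by (intro orth_sum_P_iff Qsub)
  fix x assume x: "x \<in> orth_sum \<Sigma> P Q"
  then have xc: "x \<in> carrier_vec N" and xQ: "\<And>j. j \<in> P \<Longrightarrow> restrict_vec x (xblock {j}) \<in> Q j"
    unfolding iff by blast+
  have "restrict_vec x (xblock {j}) \<in> unobs \<Sigma>" if j: "j \<in> P" for j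
  proof -
    let ?y = "restrict_vec x (xblock {j})"
    have "restrict_vec ?y (xblock {l}) \<in> Q l" if l: "l \<in> P" for l
    proof (cases "l = j")
      case True
      then show ?thesis
        using xQ[OF j] restrict_local_space[OF restrict_mem_local_space[OF xc]] by simp
    next
      case False
      \<comment> \<open>Distinct blocks are disjoint, so the other components are zero; they lie in
        \<open>Q l\<close> because it is a subspace.\<close>
      then have "restrict_vec ?y (xblock {l}) = 0\<^sub>v N"
        using xc block_inds_inj[of _ "xpart \<Sigma>" l j] by (intro eq_vecI) auto
      then show ?thesis
        using zero_mem_subspace Q[OF l] by simp
    qed
    then have "?y \<in> orth_sum \<Sigma> P Q"
      unfolding iff using xc by simp
    then show ?thesis
      using sub by blast
  qed
  then show "x \<in> Nbar \<Sigma>"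
    using xc by (simp add: Nbar_iff)
qed

text \<open>Projecting the inclusion to block j sends the left side to \<open>Ncirc_loc\<close> and
  the right side into \<open>S j\<close>.\<close>

lemma Ncirc_subset_orth_sum:
  assumes S: "\<And>j. j \<in> P \<Longrightarrow> S j \<subseteq> local_space \<Sigma> j"
    and sub: "unobs \<Sigma> \<subseteq> orth_sum \<Sigma> P S"
  shows "Ncirc \<Sigma> \<subseteq> orth_sum \<Sigma> P S"
proof -
  have "Ncirc_loc \<Sigma> j \<subseteq> S j" if "j \<in> P" for j
    using sub that orth_sum_P_iff[OF S]
    unfolding Ncirc_loc_def local_proj_eq[OF unobs_carrier] by blast
  then show ?thesis
    unfolding Ncirc_def orth_sum_def by blast
qed

end

theorem theorem4p3:
  fixes \<Sigma> :: poset_system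
  assumes "poset_causal_system \<Sigma>"
  shows "(Nbar \<Sigma> \<subseteq> unobs \<Sigma> \<and> unobs \<Sigma> \<subseteq> Ncirc \<Sigma> \<and> Ncirc \<Sigma> \<subseteq> Ntilde \<Sigma>) \<and>
    (perp \<Sigma> (Ntilde \<Sigma>) \<subseteq> perp \<Sigma> (Ncirc \<Sigma>) \<and>
     perp \<Sigma> (Ncirc \<Sigma>) \<subseteq> perp \<Sigma> (unobs \<Sigma>) \<and>
     perp \<Sigma> (unobs \<Sigma>) \<subseteq> perp \<Sigma> (Nbar \<Sigma>)) \<and>
    (\<forall>j\<in>{1..psize \<Sigma>}.
       Nbar_loc \<Sigma> j = local_space \<Sigma> j \<inter> unobs \<Sigma> \<and>
       local_proj \<Sigma> j (perp \<Sigma> (unobs \<Sigma>)) = local_space \<Sigma> j \<ominus>\<^sub>v Nbar_loc \<Sigma> j) \<and>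
    (independently_observable \<Sigma> \<longrightarrow> observable \<Sigma>) \<and>
    (observable \<Sigma> \<longrightarrow> weakly_downstream_observable \<Sigma>) \<and>
    (\<forall>Q S.
       (\<forall>j\<in>{1..psize \<Sigma>}. is_subspace \<Sigma> (Q j) \<and> Q j \<subseteq> local_space \<Sigma> j) \<and>
       (\<forall>j\<in>{1..psize \<Sigma>}. is_subspace \<Sigma> (S j) \<and> S j \<subseteq> local_space \<Sigma> j) \<and>
       orth_sum \<Sigma> {1..psize \<Sigma>} Q \<subseteq> unobs \<Sigma> \<and>
       unobs \<Sigma> \<subseteq> orth_sum \<Sigma> {1..psize \<Sigma>} S \<longrightarrow>
       orth_sum \<Sigma> {1..psize \<Sigma>} Q \<subseteq> Nbar \<Sigma> \<and>
       Ncirc \<Sigma> \<subseteq> orth_sum \<Sigma> {1..psize \<Sigma>} S)"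
proof -
  interpret causal_system \<Sigma>
    by unfold_locales (rule assms)
  have chain: "Nbar \<Sigma> \<subseteq> unobs \<Sigma>" "unobs \<Sigma> \<subseteq> Ncirc \<Sigma>" "Ncirc \<Sigma> \<subseteq> Ntilde \<Sigma>"
    by (rule Nbar_subset_unobs unobs_subset_Ncirc Ncirc_subset_Ntilde)+
  \<comment> \<open>The chain gives only an inclusion in the zero space; equality also needs the
    zero vector to be unobservable.\<close>
  have "independently_observable \<Sigma> \<longrightarrow> observable \<Sigma>"
    using chain zero_mem_unobs unfolding independently_observable_def observable_def by blast
  moreover have "observable \<Sigma> \<longrightarrow> weakly_downstream_observable \<Sigma>"
    using chain zero_mem_Nbar unfolding observable_def weakly_downstream_observable_def by blast
  ultimately show ?thesis
    using chain
    by (intro conjI allI impI ballI perp_antimono Nbar_loc_eq local_proj_perp_unobs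
        orth_sum_subset_Nbar Ncirc_subset_orth_sum) auto
qed

end
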